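(* Let $d\ge2$ be an integer, $\alpha=-1/d$ and $p\in[0,1]$. Regard the random increasing $d$-ary trees $\mathcal{T}_n=\mathcal{T}_{-1/d,n}$ as subtrees of the infinite $d$-ary tree $T_d$, with the broadcasting induced colouring $\sigma_n$ recovered from Bernoulli bond percolation with parameter $p$ on $T_d$. Let $|\mathcal{C}_n|$ be the size of the root cluster of $\mathcal{T}_n$ with colouring $\sigma_n$, and let $|\mathcal{K}_d|\in\{1,2,\ldots\}\cup\{\infty\}$ be the size of the percolation cluster of $T_d$ containing the root. Then $|\mathcal{C}_n|\to|\mathcal{K}_d|$ almost surely as $n\to\infty$.
   Context: $T_d$ is the infinite rooted tree in which every vertex has exactly $d$ children. The trees $\mathcal{T}_n=\mathcal{T}_{-1/d,n}$ are grown recursively: $\mathcal{T}_1$ is the root; $\mathcal{T}_n$ is obtained from $\mathcal{T}_{n-1}$ by choosing a vertex $v$ with probability proportional to $1-\deg^+(v)/d$, where $\deg^+(v)$ is the number of children of $v$ in $\mathcal{T}_{n-1}$, and adding a new child to $v$. Viewed inside $T_d$ (random increasing $d$-ary tree), $\mathcal{T}_1$ is the root of $T_d$ and the new child is placed at a uniformly random child position of $v$ in $T_d$ not yet occupied; the growth process is independent of the percolation. Bernoulli bond percolation with parameter $p$ on $T_d$: each edge is kept with probability $p$ and removed with probability $1-p$, independently. $\mathcal{K}_d$ is the connected component of the root of $T_d$ after percolation. The broadcasting induced colouring $\sigma_n$ (root red or blue with probability $1/2$ each; each other vertex takes its parent's colour with probability $p$ and the other colour with probability $1-p$) is obtained from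 the percolation: after choosing the root's colour uniformly, assign to each vertex $v$ the colour of its parent $u$ if the edge $uv$ is kept, and the other colour otherwise. The root cluster $\mathcal{C}_n$ is the maximal monochromatic (connected) subtree of $\mathcal{T}_n$ containing the root, so that $\mathcal{C}_n=\mathcal{T}_n\cap\mathcal{K}_d$. *)

theory Defs
  imports "HOL-Probability.Probability"
begin

text \<open>
  Ulam--Harris encoding of the infinite \<open>d\<close>-ary tree: a vertex is the word of child positions on the
  path leading to it, the root is the empty word, and the \<open>i\<close>-th child of \<open>v\<close> is \<open>v @ [i]\<close> (\<open>i < d\<close>).
  The edge between a non-root vertex and its parent is identified with its lower endpoint.
\<close>

type_synonym vertex = "nat list"

definition tree_vertices :: "nat \<Rightarrow> vertex set" where
  "tree_vertices d = lists {..<d}"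

definition tree_edges :: "nat \<Rightarrow> vertex set" where
  "tree_edges d = tree_vertices d - {[]}"

definition root_component :: "(vertex \<times> vertex) set \<Rightarrow> vertex set" where
  "root_component E = (E \<union> E\<inverse>)\<^sup>* `` {[]}"

definition ecard :: "'a set \<Rightarrow> enat" where
  "ecard A = (if finite A then enat (card A) else \<infinity>)"

definition out_degree :: "vertex set \<Rightarrow> vertex \<Rightarrow> nat" where
  "out_degree t v = card {i. v @ [i] \<in> t}"

definition attach_weight :: "nat \<Rightarrow> vertex set \<Rightarrow> vertex \<Rightarrow> real" where
  "attach_weight d t v = 1 - real (out_degree t v) / real d"

definition attach_vertex :: "nat \<Rightarrow> vertex set \<Rightarrow> vertex pmf" where
  "attach_vertex d t =
     embed_pmf (\<lambda>v. if v \<in> t then attach_weight d t v / (\<Sum>u\<in>t. attach_weight d t u) else 0)"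

text \<open>
  \<^const>\<open>embed_pmf\<close> is only specified for functions that are probability mass functions; this is
  so whenever \<open>t\<close> is a finite tree in which some vertex has a vacant child position.
\<close>

lemma pmf_attach_vertex:
  assumes fin: "finite t" and le: "\<And>v. v \<in> t \<Longrightarrow> out_degree t v \<le> d"
    and vacant: "\<exists>v\<in>t. out_degree t v < d"
  shows "pmf (attach_vertex d t) v =
    (if v \<in> t then attach_weight d t v / (\<Sum>u\<in>t. attach_weight d t u) else 0)"
proof -
  let ?S = "\<Sum>u\<in>t. attach_weight d t u"
  let ?f = "\<lambda>v. if v \<in> t then attach_weight d t v / ?S else 0"
  obtain v0 where v0: "v0 \<in> t" "out_degree t v0 < d" using vacant by blast
  have nn: "attach_weight d t u \<ge> 0" if "u \<in> t" for u
    using le[OF that] v0 by (simp add: attach_weight_def)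
  have "attach_weight d t v0 > 0" using v0 by (simp add: attach_weight_def)
  then have S: "?S > 0" using fin v0 nn by (intro sum_pos2[of t v0]) auto
  have f0: "?f u \<ge> 0" for u using nn S by simp
  have "(\<integral>\<^sup>+ u. ennreal (?f u) \<partial>count_space UNIV) = (\<Sum>u\<in>t. ennreal (?f u))"
    using fin by (intro nn_integral_count_space') (auto split: if_splits)
  also have "\<dots> = ennreal (\<Sum>u\<in>t. ?f u)"
    using nn S by (intro sum_ennreal) simp
  also have "(\<Sum>u\<in>t. ?f u) = 1"
    using S by (simp add: sum_divide_distrib[symmetric])
  finally have "(\<integral>\<^sup>+ u. ennreal (?f u) \<partial>count_space UNIV) = 1" by simp
  then show ?thesis
    unfolding attach_vertex_def using f0 by (subst pmf_embed_pmf) auto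
qed

definition growth_step :: "nat \<Rightarrow> vertex set \<Rightarrow> vertex set pmf" where
  "growth_step d t =
     bind_pmf (attach_vertex d t)
       (\<lambda>v. map_pmf (\<lambda>i. insert (v @ [i]) t) (pmf_of_set {i. i < d \<and> v @ [i] \<notin> t}))"

text \<open>
  \<open>T n\<close> is the tree with \<open>n\<close> vertices, for \<open>n \<ge> 1\<close> (\<open>T 0\<close> plays no role). The growth rule says that,
  given \<open>T 1, \<dots>, T n\<close>, the conditional law of \<open>T (n + 1)\<close> is \<open>growth_step d (T n)\<close>; this is stated
  in multiplied-out form, so that histories of probability zero impose no constraint.
\<close>

locale random_increasing_dary_tree = prob_space M
  for M :: "'w measure" and d :: nat and T :: "nat \<Rightarrow> 'w \<Rightarrow> vertex set" +
  assumes T_measurable: "\<And>n. n \<ge> 1 \<Longrightarrow> T n \<in> M \<rightarrow>\<^sub>M count_space UNIV"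
    and T_1: "AE w in M. T 1 w = {[]}"
    and T_step: "\<And>n h t'. n \<ge> 1 \<Longrightarrow>
      prob {w \<in> space M. (\<forall>k\<in>{1..n}. T k w = h k) \<and> T (n + 1) w = t'}
        = prob {w \<in> space M. \<forall>k\<in>{1..n}. T k w = h k} * pmf (growth_step d (h n)) t'"

locale bond_percolation_dary_tree = prob_space M
  for M :: "'w measure" and d :: nat and p :: real and kept :: "vertex \<Rightarrow> 'w \<Rightarrow> bool" +
  assumes kept_indep: "indep_vars (\<lambda>_. count_space UNIV) kept (tree_edges d)"
    and kept_prob: "\<And>e. e \<in> tree_edges d \<Longrightarrow> prob {w \<in> space M. kept e w} = p"

definition percolation_cluster :: "nat \<Rightarrow> (vertex \<Rightarrow> bool) \<Rightarrow> vertex set" where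
  "percolation_cluster d kp =
     root_component {(u, u @ [i]) | u i. u \<in> tree_vertices d \<and> i < d \<and> kp (u @ [i])}"

datatype colour = Red | Blue

fun other :: "colour \<Rightarrow> colour" where
  "other Red = Blue"
| "other Blue = Red"

fun induced_colouring :: "colour \<Rightarrow> (vertex \<Rightarrow> bool) \<Rightarrow> vertex \<Rightarrow> colour" where
  "induced_colouring c kp v =
     (if v = [] then c
      else if kp v then induced_colouring c kp (butlast v)
      else other (induced_colouring c kp (butlast v)))"

declare induced_colouring.simps [simp del]

text \<open>The maximal monochromatic connected subtree of \<open>t\<close> containing the root.\<close>

definition root_cluster :: "vertex set \<Rightarrow> (vertex \<Rightarrow> colour) \<Rightarrow> vertex set" where
  "root_cluster t \<sigma> =
     root_component {(u, u @ [i]) | u i. u \<in> t \<and> u @ [i] \<in> t \<and> \<sigma> u = \<sigma> (u @ [i])}"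

text \<open>
  The growth process, the root colour and the percolation configuration are mutually independent.
  They take values in different types, so this is expressed by independence of the generated
  sigma-algebras.
\<close>

locale broadcasting_dary_tree =
  random_increasing_dary_tree M d T + bond_percolation_dary_tree M d p kept
  for M :: "'w measure" and d :: nat and p :: real
    and T :: "nat \<Rightarrow> 'w \<Rightarrow> vertex set"
    and kept :: "vertex \<Rightarrow> 'w \<Rightarrow> bool"
    and root_colour :: "'w \<Rightarrow> colour" +
  assumes root_colour_measurable: "root_colour \<in> M \<rightarrow>\<^sub>M count_space UNIV"
    and root_colour_uniform: "\<And>c. prob {w \<in> space M. root_colour w = c} = 1 / 2"
    and mutual_indep:
      "indep_sets (\<lambda>k. [
          sets (vimage_algebra (space M) (\<lambda>w. \<lambda>n\<in>{1..}. T n w)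
            (Pi\<^sub>M {1..} (\<lambda>_. count_space UNIV))),
          sets (vimage_algebra (space M) root_colour (count_space UNIV)),
          sets (vimage_algebra (space M) (\<lambda>w. \<lambda>e\<in>tree_edges d. kept e w)
            (Pi\<^sub>M (tree_edges d) (\<lambda>_. count_space UNIV)))] ! k) {..<3}"

end

theory Submission
  imports Defs
begin

text \<open>
  The root cluster of a subtree \<open>t\<close> of the infinite \<open>d\<close>-ary tree is the intersection of \<open>t\<close> with the
  percolation cluster \<open>K\<close> of the root: an edge is monochromatic exactly when it is kept, and the
  path from the root to a vertex of \<open>t\<close> stays in \<open>t\<close>. Hence the claim holds on every realisation
  in which the trees \<open>T n\<close> increase and exhaust the infinite tree: the sets \<open>T n \<inter> K\<close> then increase
  to \<open>K\<close>, and so do their cardinalities. It remains to show that almost surely every vertex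
  of the infinite tree is reached by the growth.

  A vacant child position of a tree with \<open>n\<close> vertices is filled in the next step with the
  same probability as any other one, because the weight \<open>(d - k) / d\<close> of a parent
  with \<open>k\<close> children is shared by its \<open>d - k\<close> vacant positions. This probability is at least
  \<open>1 / (d n)\<close> (\<open>pmf_growth_step_ge\<close>). If \<open>b n\<close> and \<open>c n\<close> are the probabilities that a vertex
  and a given child of it are in the tree of size \<open>n\<close>, then
  \<open>c (n + 1) - c n \<ge> (b n - c n) / (d n)\<close>. Since \<open>c\<close> is bounded and the harmonic series diverges,
  \<open>b n \<longlonglongrightarrow> 1\<close> forces \<open>c n \<longlonglongrightarrow> 1\<close> (\<open>tendsto_1_if_increments_diverge\<close>). Induction along the path from
  the root shows that every vertex is reached with probability one, and there are only countably
  many vertices.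
\<close>

section \<open>Root clusters as traces of the percolation cluster\<close>

definition dary_tree :: "nat \<Rightarrow> vertex set \<Rightarrow> bool" where
  "dary_tree d t \<longleftrightarrow> finite t \<and> [] \<in> t \<and> t \<subseteq> tree_vertices d \<and> (\<forall>u i. u @ [i] \<in> t \<longrightarrow> u \<in> t)"

text \<open>
  A parent is determined by its child, so a path that starts at the root and steps towards it
  only goes back over its last edge.
\<close>

lemma root_component_parent_edges:
  assumes "E \<subseteq> {(u, u @ [i]) | u i. True}"
  shows "root_component E = E\<^sup>* `` {[]}"
proof
  show "E\<^sup>* `` {[]} \<subseteq> root_component E"
    unfolding root_component_def by (intro Image_mono rtrancl_mono) auto
  show "root_component E \<subseteq> E\<^sup>* `` {[]}"
  proof
    fix v assume "v \<in> root_component E"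
    then have "([], v) \<in> (E \<union> E\<inverse>)\<^sup>*" by (simp add: root_component_def)
    then have "([], v) \<in> E\<^sup>*"
    proof (induction rule: rtrancl_induct)
      case base
      show ?case by simp
    next
      case (step y z)
      show ?case
      proof (cases "(y, z) \<in> E")
        case True
        with step.IH show ?thesis by (rule rtrancl_into_rtrancl)
      next
        case False
        with step.hyps have zy: "(z, y) \<in> E" by blast
        with assms obtain i where y: "y = z @ [i]" by blast
        from step.IH show ?thesis
        proof (cases rule: rtranclE)
          case base
          with y show ?thesis by simp
        next
          case (step x)
          with assms obtain j where "y = x @ [j]" by blast
          with y have "x = z" by simp
          with step show ?thesis by simp
        qed
      qed
    qed
    then show "v \<in> E\<^sup>* `` {[]}" by simp
  qed
qed

lemma induced_colouring_child:
  "induced_colouring c kp u = induced_colouring c kp (u @ [i]) \<longleftrightarrow> kp (u @ [i])"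
proof -
  have "other x \<noteq> x" for x by (cases x) auto
  then show ?thesis
    by (subst (2) induced_colouring.simps) (auto dest: sym)
qed

text \<open>
  An edge is monochromatic exactly when it is kept, and a path from the root of \<open>K\<close> to a vertex
  of \<open>t\<close> runs through ancestors of that vertex, which lie in \<open>t\<close>.
\<close>

lemma root_cluster_eq_Int_percolation_cluster:
  assumes "dary_tree d t"
  shows "root_cluster t (induced_colouring c kp) = t \<inter> percolation_cluster d kp"
proof -
  let ?E = "{(u, u @ [i]) | u i. u \<in> tree_vertices d \<and> i < d \<and> kp (u @ [i])}"
  let ?F = "{(u, u @ [i]) | u i. u \<in> t \<and> u @ [i] \<in> t \<and> kp (u @ [i])}"
  have closed: "u \<in> t" if "u @ [i] \<in> t" for u i
    using assms that by (auto simp: dary_tree_def)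
  have root: "[] \<in> t" using assms by (simp add: dary_tree_def)
  have F_sub_E: "?F \<subseteq> ?E"
    using assms by (fastforce simp: dary_tree_def tree_vertices_def)
  have "?F\<^sup>* `` {[]} = t \<inter> ?E\<^sup>* `` {[]}"
  proof (intro equalityI subsetI)
    fix v assume "v \<in> ?F\<^sup>* `` {[]}"
    then have F: "([], v) \<in> ?F\<^sup>*" by simp
    then have "v \<in> t"
      by (cases rule: rtranclE) (use root in auto)
    moreover have "([], v) \<in> ?E\<^sup>*" using F rtrancl_mono[OF F_sub_E] by blast
    ultimately show "v \<in> t \<inter> ?E\<^sup>* `` {[]}" by simp
  next
    fix v assume "v \<in> t \<inter> ?E\<^sup>* `` {[]}"
    then have "([], v) \<in> ?E\<^sup>*" "v \<in> t" by auto
    then have "([], v) \<in> ?F\<^sup>*"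
    proof (induction rule: rtrancl_induct)
      case base
      show ?case by simp
    next
      case (step y z)
      then obtain i where z: "z = y @ [i]" "kp (y @ [i])" by blast
      with step.prems have "y \<in> t" using closed by blast
      moreover from this z step.prems have "(y, z) \<in> ?F" by blast
      ultimately show ?case using step.IH by (meson rtrancl_into_rtrancl)
    qed
    then show "v \<in> ?F\<^sup>* `` {[]}" by simp
  qed
  moreover have "root_cluster t (induced_colouring c kp) = ?F\<^sup>* `` {[]}"
    unfolding root_cluster_def induced_colouring_child
    by (intro root_component_parent_edges) blast
  moreover have "percolation_cluster d kp = ?E\<^sup>* `` {[]}"
    unfolding percolation_cluster_def
    by (intro root_component_parent_edges) blast
  ultimately show ?thesis by simp
qed

lemma percolation_cluster_subset: "percolation_cluster d kp \<subseteq> tree_vertices d"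
proof
  let ?E = "{(u, u @ [i]) | u i. u \<in> tree_vertices d \<and> i < d \<and> kp (u @ [i])}"
  fix v assume "v \<in> percolation_cluster d kp"
  moreover have "root_component ?E = ?E\<^sup>* `` {[]}"
    by (rule root_component_parent_edges) blast
  ultimately have "([], v) \<in> ?E\<^sup>*" by (simp add: percolation_cluster_def)
  then show "v \<in> tree_vertices d"
    by (cases rule: rtranclE) (auto simp: tree_vertices_def)
qed

text \<open>
  Every finite subset of \<open>K\<close> is eventually contained in \<open>A n\<close>: this is \<open>K\<close> itself when \<open>K\<close> is finite,
  and gives lower bounds of any size when \<open>K\<close> is infinite.
\<close>

lemma ecard_Int_tendsto:
  fixes A :: "nat \<Rightarrow> 'a set"
  assumes ev: "\<And>x. x \<in> K \<Longrightarrow> eventually (\<lambda>n. x \<in> A n) sequentially"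
  shows "(\<lambda>n. ecard (A n \<inter> K)) \<longlonglongrightarrow> ecard K"
proof -
  have ev_sub: "eventually (\<lambda>n. F \<subseteq> A n) sequentially" if "finite F" "F \<subseteq> K" for F
  proof -
    have "eventually (\<lambda>n. \<forall>x\<in>F. x \<in> A n) sequentially"
      using that ev by (intro eventually_ball_finite) auto
    then show ?thesis by eventually_elim auto
  qed
  show ?thesis
  proof (cases "finite K")
    case True
    from ev_sub[OF True subset_refl]
    have "eventually (\<lambda>n. ecard (A n \<inter> K) = ecard K) sequentially"
      by eventually_elim (simp add: Int_absorb1)
    then show ?thesis by (rule tendsto_eventually)
  next
    case False
    show ?thesis
    proof (rule order_tendstoI)
      fix a assume "a < ecard K"
      with False obtain m where a: "a = enat m"
        by (cases a) (auto simp: ecard_def)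
      from infinite_arbitrarily_large[OF False] obtain F
        where F: "finite F" "card F = Suc m" "F \<subseteq> K" by blast
      from ev_sub[OF F(1,3)]
      show "eventually (\<lambda>n. a < ecard (A n \<inter> K)) sequentially"
      proof eventually_elim
        case (elim n)
        have "Suc m \<le> card (A n \<inter> K)" if "finite (A n \<inter> K)"
          using card_mono[OF that, of F] F elim by auto
        then show ?case by (auto simp: a ecard_def)
      qed
    next
      fix a assume "ecard K < a"
      with False show "eventually (\<lambda>n. ecard (A n \<inter> K) < a) sequentially"
        by (simp add: ecard_def)
    qed
  qed
qed

section \<open>One step of the growth\<close>

definition sized_trees :: "nat \<Rightarrow> nat \<Rightarrow> vertex set set" where
  "sized_trees d n = {t. dary_tree d t \<and> card t = n}"

lemma dary_tree_prefix:
  assumes "dary_tree d t" "u @ w \<in> t"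
  shows "u \<in> t"
  using assms(2)
proof (induction w rule: rev_induct)
  case (snoc x xs)
  then have "(u @ xs) @ [x] \<in> t" by simp
  then have "u @ xs \<in> t" using assms(1) unfolding dary_tree_def by blast
  then show ?case by (rule snoc.IH)
qed simp

text \<open>A vertex has \<open>length v + 1\<close> distinct prefixes, and they all belong to the tree.\<close>

lemma dary_tree_length_less_card:
  assumes "dary_tree d t" "v \<in> t"
  shows "length v < card t"
proof -
  have "inj_on (\<lambda>k. take k v) {..length v}"
    by (rule inj_onI) (metis atMost_iff length_take min.absorb2)
  then have "card ((\<lambda>k. take k v) ` {..length v}) = Suc (length v)"
    by (simp add: card_image)
  moreover have "(\<lambda>k. take k v) ` {..length v} \<subseteq> t"
  proof
    fix x assume "x \<in> (\<lambda>k. take k v) ` {..length v}"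
    then obtain k where "x @ drop k v = v" by (metis imageE append_take_drop_id)
    with assms(2) have "x @ drop k v \<in> t" by simp
    with assms(1) show "x \<in> t" by (rule dary_tree_prefix)
  qed
  ultimately show ?thesis
    using assms(1) card_mono[of t "(\<lambda>k. take k v) ` {..length v}"]
    by (simp add: dary_tree_def)
qed

text \<open>
  Finiteness lets events about the growth process be split into finitely many histories,
  although the type of the states is uncountable.
\<close>

lemma finite_sized_trees: "finite (sized_trees d n)"
proof (rule finite_subset)
  show "sized_trees d n \<subseteq> Pow {v. set v \<subseteq> {..<d} \<and> length v \<le> n}"
  proof (intro subsetI PowI)
    fix t v assume "t \<in> sized_trees d n" "v \<in> t"
    then have t: "dary_tree d t" "card t = n" by (simp_all add: sized_trees_def)
    then have "set v \<subseteq> {..<d}"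
      using \<open>v \<in> t\<close> by (auto simp: dary_tree_def tree_vertices_def)
    moreover have "length v \<le> n"
      using dary_tree_length_less_card[OF t(1) \<open>v \<in> t\<close>] t(2) by simp
    ultimately show "v \<in> {v. set v \<subseteq> {..<d} \<and> length v \<le> n}" by simp
  qed
qed (simp add: finite_lists_length_le)

lemma dary_tree_insert:
  assumes "dary_tree d t" "u \<in> t" "i < d"
  shows "dary_tree d (insert (u @ [i]) t)"
  using assms by (auto simp: dary_tree_def tree_vertices_def)

text \<open>
  A longest word in a finite tree has no children, so the growth never gets stuck and the
  attachment weights define a probability distribution.
\<close>

lemma
  assumes t: "dary_tree d t" and d: "d \<ge> 1"
  shows out_degree_le: "out_degree t u \<le> d"
    and pmf_attach_vertex_tree: "pmf (attach_vertex d t) v =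
      (if v \<in> t then attach_weight d t v / (\<Sum>u\<in>t. attach_weight d t u) else 0)"
    and total_weight_pos: "(\<Sum>u\<in>t. attach_weight d t u) > 0"
    and total_weight_le: "(\<Sum>u\<in>t. attach_weight d t u) \<le> card t"
proof -
  have le: "out_degree t u \<le> d" for u
  proof -
    have "{i. u @ [i] \<in> t} \<subseteq> {..<d}"
      using t by (auto simp: dary_tree_def tree_vertices_def)
    then have "card {i. u @ [i] \<in> t} \<le> card {..<d}" by (intro card_mono) auto
    then show ?thesis by (simp add: out_degree_def)
  qed
  then show "out_degree t u \<le> d" .
  have fin: "finite t" and ne: "t \<noteq> {}" using t by (auto simp: dary_tree_def)
  have "Max (length ` t) \<in> length ` t" using fin ne by (intro Max_in) auto
  then obtain x where x: "x \<in> t" "length x = Max (length ` t)" by auto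
  have longest: "length y \<le> length x" if "y \<in> t" for y
    using fin that by (simp add: x(2))
  have "x @ [i] \<notin> t" for i using longest[of "x @ [i]"] by auto
  then have deg_x: "out_degree t x = 0" by (simp add: out_degree_def)
  show "pmf (attach_vertex d t) v =
      (if v \<in> t then attach_weight d t v / (\<Sum>u\<in>t. attach_weight d t u) else 0)"
    by (rule pmf_attach_vertex) (use fin le x(1) deg_x d in \<open>auto intro!: bexI[of _ x]\<close>)
  have nn: "attach_weight d t u \<ge> 0" for u
    using le[of u] d by (simp add: attach_weight_def)
  show "(\<Sum>u\<in>t. attach_weight d t u) > 0"
    by (rule sum_pos2[OF fin x(1)]) (use nn deg_x in \<open>auto simp: attach_weight_def\<close>)
  have "(\<Sum>u\<in>t. attach_weight d t u) \<le> (\<Sum>u\<in>t. 1)"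
    by (intro sum_mono) (simp add: attach_weight_def)
  then show "(\<Sum>u\<in>t. attach_weight d t u) \<le> card t" by simp
qed

lemma card_vacant:
  assumes "dary_tree d t"
  shows "card {i. i < d \<and> u @ [i] \<notin> t} = d - out_degree t u"
proof -
  have sub: "{i. u @ [i] \<in> t} \<subseteq> {..<d}"
    using assms by (auto simp: dary_tree_def tree_vertices_def)
  have "{i. i < d \<and> u @ [i] \<notin> t} = {..<d} - {i. u @ [i] \<in> t}" by auto
  moreover have "finite {i. u @ [i] \<in> t}" using finite_subset[OF sub] by simp
  ultimately show ?thesis
    using card_Diff_subset[OF _ sub] by (simp add: out_degree_def)
qed

lemma set_pmf_growth_step:
  assumes t: "dary_tree d t" and d: "d \<ge> 1"
  shows "set_pmf (growth_step d t) \<subseteq> {insert (u @ [i]) t | u i. u \<in> t \<and> i < d \<and> u @ [i] \<notin> t}"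
proof
  fix t' assume "t' \<in> set_pmf (growth_step d t)"
  then obtain u where u: "u \<in> set_pmf (attach_vertex d t)"
    and t': "t' \<in> (\<lambda>i. insert (u @ [i]) t) ` set_pmf (pmf_of_set {i. i < d \<and> u @ [i] \<notin> t})"
    by (auto simp: growth_step_def)
  from u have "pmf (attach_vertex d t) u \<noteq> 0" by (simp add: set_pmf_iff)
  then have "u \<in> t" "attach_weight d t u \<noteq> 0"
    by (auto simp: pmf_attach_vertex_tree[OF t d] split: if_splits)
  \<comment> \<open>A chosen parent has positive weight, hence a vacant position; otherwise
      the uniform distribution on its vacant positions would be unspecified.\<close>
  then have "out_degree t u < d"
    using out_degree_le[OF t d, of u] d by (cases "out_degree t u = d") (auto simp: attach_weight_def)
  then have "card {i. i < d \<and> u @ [i] \<notin> t} \<noteq> 0"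
    by (simp add: card_vacant[OF t])
  then have "{i. i < d \<and> u @ [i] \<notin> t} \<noteq> {}" by (metis card.empty)
  then have "set_pmf (pmf_of_set {i. i < d \<and> u @ [i] \<notin> t}) = {i. i < d \<and> u @ [i] \<notin> t}"
    by (intro set_pmf_of_set) auto
  with t' \<open>u \<in> t\<close>
  show "t' \<in> {insert (u @ [i]) t | u i. u \<in> t \<and> i < d \<and> u @ [i] \<notin> t}" by auto
qed

lemma set_pmf_growth_step_sized:
  assumes "t \<in> sized_trees d n" "d \<ge> 1" "t' \<in> set_pmf (growth_step d t)"
  shows "t' \<in> sized_trees d (Suc n)" "t \<subseteq> t'"
proof -
  have t: "dary_tree d t" "card t = n" using assms by (auto simp: sized_trees_def)
  then have "finite t" by (simp add: dary_tree_def)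
  obtain u i where "t' = insert (u @ [i]) t" "u \<in> t" "i < d" "u @ [i] \<notin> t"
    using set_pmf_growth_step[OF t(1) assms(2)] assms(3) by auto
  with t \<open>finite t\<close> show "t' \<in> sized_trees d (Suc n)" "t \<subseteq> t'"
    by (auto simp: sized_trees_def dary_tree_insert)
qed

text \<open>
  With \<open>k\<close> the number of children of \<open>u\<close>, the probability is \<open>((d - k) / d) / S\<close> for the choice of \<open>u\<close>
  times \<open>1 / (d - k)\<close> for the choice of the position, where the total weight \<open>S\<close> is at most \<open>n\<close>.
\<close>

lemma pmf_growth_step_ge:
  assumes t: "t \<in> sized_trees d n" and d: "d \<ge> 1" and u: "u \<in> t" "i < d" "u @ [i] \<notin> t"
  shows "pmf (growth_step d t) (insert (u @ [i]) t) \<ge> 1 / (real d * real n)"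
proof -
  have t: "dary_tree d t" "card t = n" using assms by (auto simp: sized_trees_def)
  then have fin: "finite t" by (simp add: dary_tree_def)
  let ?V = "\<lambda>v. {i. i < d \<and> v @ [i] \<notin> t}"
  let ?f = "\<lambda>v. map_pmf (\<lambda>i. insert (v @ [i]) t) (pmf_of_set (?V v))"
  let ?t' = "insert (u @ [i]) t"
  define S where "S = (\<Sum>u\<in>t. attach_weight d t u)"
  define k where "k = out_degree t u"
  have S: "S > 0" "S \<le> n"
    using total_weight_pos[OF t(1) d] total_weight_le[OF t(1) d] t(2) by (simp_all add: S_def)
  have iV: "i \<in> ?V u" "finite (?V u)" using u by auto
  then have cV: "card (?V u) > 0" by (auto simp: card_gt_0_iff)
  then have kd: "k < d" and cV_eq: "real (card (?V u)) = real d - real k"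
    by (simp_all add: card_vacant[OF t(1)] k_def)
  have V: "set_pmf (pmf_of_set (?V u)) = ?V u"
    using iV by (intro set_pmf_of_set) auto
  have inj: "inj_on (\<lambda>i. insert (u @ [i]) t) (?V u)"
  proof (rule inj_onI)
    fix a b assume "a \<in> ?V u" "insert (u @ [a]) t = insert (u @ [b]) t"
    moreover from this(2) have "u @ [a] \<in> insert (u @ [b]) t" by blast
    ultimately show "a = b" by simp
  qed
  have "pmf (?f u) ?t' = pmf (pmf_of_set (?V u)) i"
    by (rule pmf_map_inj) (unfold V, fact inj, fact iV(1))
  also have "\<dots> = 1 / (real d - real k)"
    using iV cV_eq by (subst pmf_of_set) auto
  finally have f: "pmf (?f u) ?t' = 1 / (real d - real k)" .
  have a: "pmf (attach_vertex d t) u = (1 - real k / real d) / S"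
    using u by (simp add: pmf_attach_vertex_tree[OF t(1) d] S_def attach_weight_def k_def)
  have "1 / (real d * real n) \<le> 1 / (real d * S)"
    using S d by (intro divide_left_mono mult_left_mono) auto
  also have "\<dots> = pmf (?f u) ?t' * pmf (attach_vertex d t) u"
    unfolding f a using kd S by (simp add: field_simps)
  also have "\<dots> \<le> (\<Sum>v\<in>t. pmf (?f v) ?t' * pmf (attach_vertex d t) v)"
    using fin u by (intro member_le_sum) auto
  also have "\<dots> = pmf (growth_step d t) ?t'"
    unfolding growth_step_def pmf_bind
    by (subst integral_measure_pmf_real[where A = t])
       (use fin in \<open>auto simp: set_pmf_iff pmf_attach_vertex_tree[OF t(1) d] split: if_splits\<close>)
  finally show ?thesis .
qed

section \<open>Every vertex is reached\<close>

text \<open>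
  If \<open>c\<close> had a limit \<open>L < 1\<close>, then \<open>b - c\<close> would eventually exceed \<open>(1 - L) / 2\<close>, so the
  increments of \<open>c\<close> would dominate a multiple of the divergent series of the \<open>q n\<close>.
\<close>

lemma tendsto_1_if_increments_diverge:
  fixes b c q :: "nat \<Rightarrow> real"
  assumes b: "b \<longlonglongrightarrow> 1" and mono: "incseq c" and le1: "\<And>n. c n \<le> 1"
    and q: "\<And>n. q n \<ge> 0" "\<not> summable q"
    and step: "\<And>n. c (Suc n) \<ge> c n + q n * (b n - c n)"
  shows "c \<longlonglongrightarrow> 1"
proof -
  obtain L where L: "c \<longlonglongrightarrow> L" and cL: "\<And>n. c n \<le> L"
    by (rule incseq_convergent[OF mono]) (use le1 in blast)+
  have "L \<le> 1" by (rule LIMSEQ_le_const2[OF L]) (use le1 in auto)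
  moreover have False if "L < 1"
  proof -
    define e where "e = (1 - L) / 2"
    have e: "e > 0" using that by (simp add: e_def)
    have "eventually (\<lambda>n. b n > (1 + L) / 2) sequentially"
      using that by (intro order_tendstoD(1)[OF b]) simp
    then have "eventually (\<lambda>n. norm (e * q n) \<le> c (Suc n) - c n) sequentially"
    proof eventually_elim
      case (elim n)
      then have "e \<le> b n - c n" using cL[of n] by (simp add: e_def field_simps)
      then have "q n * e \<le> q n * (b n - c n)" using q(1) by (intro mult_left_mono) auto
      also have "\<dots> \<le> c (Suc n) - c n" using step[of n] by simp
      finally show ?case using e q(1)[of n] by (simp add: mult.commute)
    qed
    moreover have "summable (\<lambda>n. c (Suc n) - c n)"
      using telescope_summable[OF L] .
    ultimately have "summable (\<lambda>n. e * q n)"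
      by (rule summable_comparison_test_ev)
    then show False using q(2) e by simp
  qed
  ultimately have "L = 1" by (meson antisym not_le)
  with L show ?thesis by simp
qed

context random_increasing_dary_tree
begin

lemma T_event:
  assumes "n \<ge> 1"
  shows "{w \<in> space M. P (T n w)} \<in> sets M"
proof -
  have "{w \<in> space M. P (T n w)} = T n -` {t. P t} \<inter> space M" by auto
  also have "\<dots> \<in> sets M" using T_measurable[OF assms] by (rule measurable_sets) simp
  finally show ?thesis .
qed

definition history :: "nat \<Rightarrow> (nat \<Rightarrow> vertex set) \<Rightarrow> 'w set" where
  "history n h = {w \<in> space M. \<forall>k\<in>{1..n}. T k w = h k}"

lemma history_event [measurable]: "history n h \<in> sets M"
proof -
  have "history n h = {w \<in> space M. \<forall>k\<in>{1..n}. w \<in> {w \<in> space M. T k w = h k}}"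
    by (auto simp: history_def)
  also have "\<dots> \<in> sets M"
    by (intro sets.sets_Collect_finite_All) (auto intro: T_event)
  finally show ?thesis .
qed

lemma prob_history_step:
  assumes "n \<ge> 1"
  shows "prob (history n h \<inter> {w \<in> space M. T (n + 1) w = t'})
    = prob (history n h) * pmf (growth_step d (h n)) t'"
proof -
  have "history n h \<inter> {w \<in> space M. T (n + 1) w = t'}
    = {w \<in> space M. (\<forall>k\<in>{1..n}. T k w = h k) \<and> T (n + 1) w = t'}"
    by (auto simp: history_def)
  then show ?thesis using T_step[OF assms, of h t'] by (simp add: history_def)
qed

text \<open>
  The growth rule determines the conditional law on every history separately. Since the
  support is finite, its point masses add up to one, which leaves no room for other states.
\<close>

lemma AE_history_step:
  assumes n: "n \<ge> 1" and fin: "finite (set_pmf (growth_step d (h n)))"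
  shows "AE w in M. w \<in> history n h \<longrightarrow> T (n + 1) w \<in> set_pmf (growth_step d (h n))"
proof -
  let ?S = "set_pmf (growth_step d (h n))"
  let ?B = "\<lambda>t'. history n h \<inter> {w \<in> space M. T (n + 1) w = t'}"
  have B: "?B t' \<in> sets M" for t' by (intro sets.Int history_event T_event) simp
  have "prob (\<Union>t'\<in>?S. ?B t') = (\<Sum>t'\<in>?S. prob (?B t'))"
    using fin B by (intro finite_measure_finite_Union) (auto simp: disjoint_family_on_def)
  also have "\<dots> = prob (history n h) * (\<Sum>t'\<in>?S. pmf (growth_step d (h n)) t')"
    by (simp add: prob_history_step[OF n, simplified] sum_distrib_left)
  also have "(\<Sum>t'\<in>?S. pmf (growth_step d (h n)) t') = 1"
    using fin by (intro sum_pmf_eq_1) auto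
  finally have eq: "prob (\<Union>t'\<in>?S. ?B t') = prob (history n h)" by simp
  have U: "(\<Union>t'\<in>?S. ?B t') \<in> sets M" using fin B by blast
  have "prob (history n h - (\<Union>t'\<in>?S. ?B t')) = prob (history n h) - prob (\<Union>t'\<in>?S. ?B t')"
    using U by (intro finite_measure_Diff history_event) auto
  also have "\<dots> = 0" unfolding eq by simp
  finally have "history n h - (\<Union>t'\<in>?S. ?B t') \<in> null_sets M"
    using U by (intro null_setsI sets.Diff history_event) (simp_all only: emeasure_eq_measure ennreal_0)
  then have "AE w in M. w \<notin> history n h - (\<Union>t'\<in>?S. ?B t')" by (rule AE_not_in)
  then show ?thesis
    using AE_space by eventually_elim auto
qed

text \<open>
  The histories in the finite set \<open>?H\<close> below carry all the mass of the first \<open>n\<close> steps, so the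
  statement about single histories extends to the process.
\<close>

lemma AE_growth_step_if_sized:
  assumes n: "n \<ge> 1" and d: "d \<ge> 1"
    and sized: "AE w in M. \<forall>k\<in>{1..n}. T k w \<in> sized_trees d k"
  shows "AE w in M. T (n + 1) w \<in> set_pmf (growth_step d (T n w))"
proof -
  let ?H = "Pi\<^sub>E {1..n} (sized_trees d)"
  have fin: "finite ?H" by (intro finite_PiE) (auto simp: finite_sized_trees)
  have "AE w in M. \<forall>h\<in>?H. w \<in> history n h \<longrightarrow> T (n + 1) w \<in> set_pmf (growth_step d (h n))"
  proof (rule AE_finite_allI[OF fin])
    fix h assume "h \<in> ?H"
    then have "h n \<in> sized_trees d n" using n by auto
    then have "set_pmf (growth_step d (h n)) \<subseteq> sized_trees d (Suc n)"
      using set_pmf_growth_step_sized(1) d by blast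
    then show "AE w in M. w \<in> history n h \<longrightarrow> T (n + 1) w \<in> set_pmf (growth_step d (h n))"
      by (intro AE_history_step n finite_subset[OF _ finite_sized_trees])
  qed
  with sized AE_space show ?thesis
  proof eventually_elim
    case (elim w)
    let ?h = "restrict (\<lambda>k. T k w) {1..n}"
    have "?h \<in> ?H" "w \<in> history n ?h" using elim by (auto simp: history_def)
    with elim(3) have "T (n + 1) w \<in> set_pmf (growth_step d (?h n))" by blast
    then show ?case using n by simp
  qed
qed

lemma AE_sized_upto:
  assumes "n \<ge> 1" "d \<ge> 1"
  shows "AE w in M. \<forall>k\<in>{1..n}. T k w \<in> sized_trees d k"
  using assms(1)
proof (induction n rule: nat_induct_at_least)
  case base
  show ?case using T_1
    by eventually_elim (auto simp: sized_trees_def dary_tree_def tree_vertices_def)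
next
  case (Suc n)
  from AE_growth_step_if_sized[OF Suc.hyps assms(2) Suc.IH] Suc.IH
  show ?case
  proof eventually_elim
    case (elim w)
    then have "T n w \<in> sized_trees d n" using Suc.hyps by auto
    then have "T (n + 1) w \<in> sized_trees d (Suc n)"
      using set_pmf_growth_step_sized(1) assms(2) elim(1) by blast
    with elim(2) show ?case by (auto simp: le_Suc_eq)
  qed
qed

lemma AE_sized_increasing:
  assumes d: "d \<ge> 1"
  shows "AE w in M. \<forall>n\<ge>1. T n w \<in> sized_trees d n \<and> T n w \<subseteq> T (Suc n) w"
proof -
  have "AE w in M. n \<ge> 1 \<longrightarrow> T n w \<in> sized_trees d n \<and> T n w \<subseteq> T (Suc n) w" for n
  proof (cases "n \<ge> 1")
    case True
    note s = AE_sized_upto[OF True d]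
    from s AE_growth_step_if_sized[OF True d s]
    show ?thesis
    proof eventually_elim
      case (elim w)
      then have "T n w \<in> sized_trees d n" using True by auto
      then show ?case using set_pmf_growth_step_sized(2)[OF _ d] elim(2) by auto
    qed
  qed auto
  then show ?thesis by (simp add: AE_all_countable)
qed

lemma prob_eq_sum_histories:
  assumes n: "n \<ge> 1" and d: "d \<ge> 1" and B: "B \<in> sets M"
  shows "prob B = (\<Sum>h\<in>Pi\<^sub>E {1..n} (sized_trees d). prob (history n h \<inter> B))"
proof -
  let ?H = "Pi\<^sub>E {1..n} (sized_trees d)"
  have fin: "finite ?H" by (intro finite_PiE) (auto simp: finite_sized_trees)
  have "h = h'" if "h \<in> ?H" "h' \<in> ?H" "w \<in> history n h" "w \<in> history n h'" for h h' w
    using that(1,2) by (rule PiE_ext) (use that(3,4) in \<open>auto simp: history_def\<close>)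
  then have "disjoint_family_on (\<lambda>h. history n h \<inter> B) ?H"
    unfolding disjoint_family_on_def by blast
  then have "(\<Sum>h\<in>?H. prob (history n h \<inter> B)) = prob (\<Union>h\<in>?H. history n h \<inter> B)"
    using fin B by (intro finite_measure_finite_Union[symmetric]) auto
  also have "\<dots> = prob B"
  proof (rule finite_measure_eq_AE)
    show "(\<Union>h\<in>?H. history n h \<inter> B) \<in> sets M"
      by (intro sets.finite_UN fin sets.Int history_event B)
    show "AE w in M. w \<in> (\<Union>h\<in>?H. history n h \<inter> B) \<longleftrightarrow> w \<in> B"
      using AE_sized_upto[OF n d] AE_space
    proof eventually_elim
      case (elim w)
      then have "restrict (\<lambda>k. T k w) {1..n} \<in> ?H"
        "w \<in> history n (restrict (\<lambda>k. T k w) {1..n})" by (auto simp: history_def)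
      then show ?case by blast
    qed
  qed (rule B)
  finally show ?thesis by simp
qed

text \<open>
  On each history the vacant position is filled with conditional probability at least
  \<open>1 / (d n)\<close>; the histories in which it is not vacant at time \<open>n\<close> contribute nothing
  to either side.
\<close>

lemma prob_new_child_ge:
  assumes n: "n \<ge> 1" and d: "d \<ge> 1" and i: "i < d"
  shows "prob {w \<in> space M. u \<in> T n w \<and> u @ [i] \<notin> T n w \<and> u @ [i] \<in> T (Suc n) w}
    \<ge> 1 / (real d * real n) * prob {w \<in> space M. u \<in> T n w \<and> u @ [i] \<notin> T n w}"
    (is "prob ?B \<ge> ?q * prob ?A")
proof -
  let ?H = "Pi\<^sub>E {1..n} (sized_trees d)"
  have A: "?A \<in> sets M" using n by (rule T_event)
  have "?B = ?A \<inter> {w \<in> space M. u @ [i] \<in> T (Suc n) w}" by auto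
  then have B: "?B \<in> sets M" using A T_event[of "Suc n" "\<lambda>t. u @ [i] \<in> t"] by simp
  have "?q * prob ?A = (\<Sum>h\<in>?H. ?q * prob (history n h \<inter> ?A))"
    by (simp add: prob_eq_sum_histories[OF n d A] sum_distrib_left)
  also have "\<dots> \<le> (\<Sum>h\<in>?H. prob (history n h \<inter> ?B))"
  proof (rule sum_mono)
    fix h assume "h \<in> ?H"
    then have h: "h n \<in> sized_trees d n" using n by auto
    have hn: "T n w = h n" if "w \<in> history n h" for w
      using that n by (auto simp: history_def)
    show "?q * prob (history n h \<inter> ?A) \<le> prob (history n h \<inter> ?B)"
    proof (cases "u \<in> h n \<and> u @ [i] \<notin> h n")
      case True
      let ?t' = "insert (u @ [i]) (h n)"
      have "?q * prob (history n h \<inter> ?A) \<le> ?q * prob (history n h)"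
        by (intro mult_left_mono finite_measure_mono) auto
      also have "\<dots> \<le> pmf (growth_step d (h n)) ?t' * prob (history n h)"
        using pmf_growth_step_ge[OF h d _ i] True by (intro mult_right_mono) auto
      also have "\<dots> = prob (history n h \<inter> {w \<in> space M. T (n + 1) w = ?t'})"
        by (simp add: prob_history_step[OF n, simplified])
      also have "\<dots> \<le> prob (history n h \<inter> ?B)"
        using True B by (intro finite_measure_mono) (auto simp: hn)
      finally show ?thesis .
    next
      case False
      then have "history n h \<inter> ?A = {}" using hn by auto
      then show ?thesis by simp
    qed
  qed
  also have "\<dots> = prob ?B" by (simp add: prob_eq_sum_histories[OF n d B])
  finally show ?thesis .
qed

text \<open>
  Along the path from the root: the child gains at least \<open>(b n - c n) / (d n)\<close> in each step, since
  \<open>b n - c n\<close> bounds from below the probability that the parent is present and the child is not.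
\<close>

lemma prob_vertex_tendsto_1:
  assumes d: "d \<ge> 1" and "v \<in> tree_vertices d"
  shows "(\<lambda>n. prob {w \<in> space M. v \<in> T (Suc n) w}) \<longlonglongrightarrow> 1"
  using assms(2)
proof (induction v rule: rev_induct)
  case Nil
  have "prob {w \<in> space M. [] \<in> T (Suc n) w} = 1" for n
    using AE_sized_increasing[OF d]
    by (subst prob_Collect_eq_1[OF T_event]) (auto simp: sized_trees_def dary_tree_def)
  then show ?case by simp
next
  case (snoc i u)
  then have i: "i < d" and u: "u \<in> tree_vertices d" by (auto simp: tree_vertices_def)
  let ?b = "\<lambda>n. prob {w \<in> space M. u \<in> T (Suc n) w}"
  let ?c = "\<lambda>n. prob {w \<in> space M. u @ [i] \<in> T (Suc n) w}"
  let ?q = "\<lambda>n. 1 / (real d * real (Suc n))"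
  have ev: "{w \<in> space M. P (T (Suc n) w)} \<in> sets M" for P n by (rule T_event) simp
  show ?case
  proof (rule tendsto_1_if_increments_diverge[where b = ?b and q = ?q])
    show "?b \<longlonglongrightarrow> 1" using snoc.IH u by simp
    show "incseq ?c"
    proof (rule incseq_SucI, rule finite_measure_mono_AE)
      fix n
      show "AE w in M. w \<in> {w \<in> space M. u @ [i] \<in> T (Suc n) w}
          \<longrightarrow> w \<in> {w \<in> space M. u @ [i] \<in> T (Suc (Suc n)) w}"
        using AE_sized_increasing[OF d]
      proof eventually_elim
        case (elim w)
        then have "T (Suc n) w \<subseteq> T (Suc (Suc n)) w" by simp
        then show ?case by auto
      qed
    qed (rule ev)
    show "?c n \<le> 1" for n by simp
    show "?q n \<ge> 0" for n by simp
    show "\<not> summable ?q"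
    proof
      assume "summable ?q"
      then have "summable (\<lambda>n. real d * ?q n)" by (rule summable_mult)
      also have "(\<lambda>n. real d * ?q n) = (\<lambda>n. inverse (real (Suc n)))"
        using d by (simp add: inverse_eq_divide del: of_nat_Suc)
      finally have "summable (\<lambda>n. inverse (real (Suc n)))" .
      then have "summable (\<lambda>n. inverse (real n))" by (subst (asm) summable_Suc_iff)
      then show False using not_summable_harmonic[where 'a = real] by simp
    qed
    fix n
    let ?X = "{w \<in> space M. u @ [i] \<in> T (Suc n) w}"
    let ?A = "{w \<in> space M. u \<in> T (Suc n) w \<and> u @ [i] \<notin> T (Suc n) w}"
    let ?B = "{w \<in> space M. u \<in> T (Suc n) w \<and> u @ [i] \<notin> T (Suc n) w \<and> u @ [i] \<in> T (Suc (Suc n)) w}"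
    have "?B = ?A \<inter> {w \<in> space M. u @ [i] \<in> T (Suc (Suc n)) w}" by auto
    then have B: "?B \<in> sets M" using ev by simp
    have "?b n \<le> prob (?X \<union> ?A)"
      using ev by (intro finite_measure_mono sets.Un) auto
    also have "\<dots> = ?c n + prob ?A"
      using ev by (intro finite_measure_Union) auto
    finally have "?q n * (?b n - ?c n) \<le> ?q n * prob ?A"
      by (intro mult_left_mono) auto
    also have "\<dots> \<le> prob ?B"
      using prob_new_child_ge[OF _ d i, of "Suc n" u] by simp
    finally have "?c n + ?q n * (?b n - ?c n) \<le> ?c n + prob ?B" by simp
    also have "\<dots> = prob (?X \<union> ?B)"
      using ev B by (intro finite_measure_Union[symmetric]) auto
    also have "\<dots> \<le> ?c (Suc n)"
    proof (rule finite_measure_mono_AE)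
      show "AE w in M. w \<in> ?X \<union> ?B \<longrightarrow> w \<in> {w \<in> space M. u @ [i] \<in> T (Suc (Suc n)) w}"
        using AE_sized_increasing[OF d]
      proof eventually_elim
        case (elim w)
        then have "T (Suc n) w \<subseteq> T (Suc (Suc n)) w" by simp
        then show ?case by auto
      qed
    qed (rule ev)
    finally show "?c n + ?q n * (?b n - ?c n) \<le> ?c (Suc n)" .
  qed
qed

lemma AE_all_vertices_reached:
  assumes d: "d \<ge> 1"
  shows "AE w in M. \<forall>v\<in>tree_vertices d. \<exists>n\<ge>1. v \<in> T n w"
proof -
  have "AE w in M. \<exists>n. v \<in> T (Suc n) w" if v: "v \<in> tree_vertices d" for v
  proof -
    let ?U = "\<Union>n. {w \<in> space M. v \<in> T (Suc n) w}"
    have ev: "{w \<in> space M. v \<in> T (Suc n) w} \<in> sets M" for n by (rule T_event) simp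
    then have U: "?U \<in> sets M" by blast
    have "1 \<le> prob ?U"
      by (rule LIMSEQ_le_const2[OF prob_vertex_tendsto_1[OF d v]])
        (use U in \<open>auto intro!: exI[of _ 0] finite_measure_mono\<close>)
    then have "prob ?U = 1" by (simp add: antisym)
    from AE_prob_1[OF this] show ?thesis by eventually_elim auto
  qed
  then have "AE w in M. \<forall>v\<in>tree_vertices d. \<exists>n. v \<in> T (Suc n) w"
    by (subst AE_ball_countable) auto
  then show ?thesis
    by eventually_elim (metis Suc_le_mono le0 One_nat_def)
qed

end

section \<open>Convergence of the root cluster\<close>

theorem theorem2p12:
  fixes M :: "'w measure" and d :: nat and p :: real
    and T :: "nat \<Rightarrow> 'w \<Rightarrow> vertex set"
    and kept :: "vertex \<Rightarrow> 'w \<Rightarrow> bool"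
    and root_colour :: "'w \<Rightarrow> colour"
  assumes "d \<ge> 2" and "p \<in> {0..1}"
    and "broadcasting_dary_tree M d p T kept root_colour"
  shows "AE w in M.
    (\<lambda>n. ecard (root_cluster (T n w) (induced_colouring (root_colour w) (\<lambda>e. kept e w))))
      \<longlonglongrightarrow> ecard (percolation_cluster d (\<lambda>e. kept e w))"
proof -
  interpret broadcasting_dary_tree M d p T kept root_colour by fact
  have d: "d \<ge> 1" using assms(1) by simp
  from AE_sized_increasing[OF d] AE_all_vertices_reached[OF d]
  show ?thesis
  proof eventually_elim
    case (elim w)
    let ?K = "percolation_cluster d (\<lambda>e. kept e w)"
    have mono: "T m w \<subseteq> T n w" if "1 \<le> m" "m \<le> n" for m n
      using that(2)
    proof (induction n rule: dec_induct)
      case (step k)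
      then have "T k w \<subseteq> T (Suc k) w" using elim(1) that(1) by simp
      with step.IH show ?case by blast
    qed simp
    have "(\<lambda>n. ecard (T n w \<inter> ?K)) \<longlonglongrightarrow> ecard ?K"
    proof (rule ecard_Int_tendsto)
      fix v assume "v \<in> ?K"
      with percolation_cluster_subset elim(2) obtain m where "m \<ge> 1" "v \<in> T m w" by blast
      then show "eventually (\<lambda>n. v \<in> T n w) sequentially"
        using mono[of m] by (intro eventually_sequentiallyI[of m]) blast
    qed
    \<comment> \<open>Only indices from one on matter: \<open>T 0\<close> is arbitrary and need not be a tree.\<close>
    moreover have "eventually (\<lambda>n. ecard (T n w \<inter> ?K) =
        ecard (root_cluster (T n w) (induced_colouring (root_colour w) (\<lambda>e. kept e w)))) sequentially"
      using eventually_ge_at_top[of 1]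
    proof eventually_elim
      case (elim n)
      then have "dary_tree d (T n w)"
        using \<open>\<forall>n\<ge>1. T n w \<in> sized_trees d n \<and> T n w \<subseteq> T (Suc n) w\<close> by (simp add: sized_trees_def)
      then show ?case by (simp add: root_cluster_eq_Int_percolation_cluster)
    qed
    ultimately show ?case by (rule Lim_transform_eventually)
  qed
qed

end
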